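(* Let $(X,d)$ be a metric tree. Then for every real $\lambda\geq 1$ the kernel $X\times X\to\mathbf{R}_{\geq 0}$, $(x,y)\mapsto \lambda^{d(x,y)}$, is of real hyperbolic type on $X$.
   Context: "Metric tree" has its usual meaning, including $\mathbf{R}$-trees and (geometric realisations of) simplicial trees: a metric space in which any two points are joined by a unique arc, and this arc is a geodesic segment. A symmetric function $\Phi\colon X\times X\to\mathbf{R}$ is a (real) kernel of positive type if $\sum_{j,k=1}^n c_jc_k\Phi(x_j,x_k)\geq 0$ for all $n\in\mathbf{N}$, all $c_1,\dots,c_n\in\mathbf{R}$ and all $x_1,\dots,x_n\in X$. A symmetric function $\beta\colon X\times X\to\mathbf{R}_{\geq 0}$ taking the constant value $1$ on the diagonal is called a kernel of real hyperbolic type if for every $x_0\in X$ the kernel $(x,y)\mapsto \beta(x,x_0)\beta(x_0,y)-\beta(x,y)$ is of positive type (equivalently, for some $x_0\in X$; equivalently, there is a map $f$ from $X$ to a real hyperbolic space $\mathbf{H}_{\mathbf{R}}^\kappa$ of constant curvature $-1$ and some, possibly infinite, dimension $\kappa$ with $\beta(x,y)=\cosh d(f(x),f(y))$ for all $x,y\in X$). *)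

theory Defs
  imports "HOL-Analysis.Analysis"
begin

definition arc_between :: "'a set \<Rightarrow> ('a \<Rightarrow> 'a \<Rightarrow> real) \<Rightarrow> 'a set \<Rightarrow> 'a \<Rightarrow> 'a \<Rightarrow> bool" where
  "arc_between X d A x y \<longleftrightarrow>
     (\<exists>g. pathin (Metric_space.mtopology X d) g \<and> inj_on g {0..1} \<and>
          g 0 = x \<and> g 1 = y \<and> A = g ` {0..1})"

definition geodesic_segment_between ::
    "'a set \<Rightarrow> ('a \<Rightarrow> 'a \<Rightarrow> real) \<Rightarrow> 'a set \<Rightarrow> 'a \<Rightarrow> 'a \<Rightarrow> bool" where
  "geodesic_segment_between X d A x y \<longleftrightarrow>
     (\<exists>\<gamma>. \<gamma> ` {0..d x y} \<subseteq> X \<and>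
          (\<forall>s\<in>{0..d x y}. \<forall>t\<in>{0..d x y}. d (\<gamma> s) (\<gamma> t) = \<bar>s - t\<bar>) \<and>
          \<gamma> 0 = x \<and> \<gamma> (d x y) = y \<and> A = \<gamma> ` {0..d x y})"

text \<open>
  Arcs are identified with their images, since uniqueness can only hold up to
  reparametrisation. An injective path has distinct endpoints, so the condition is imposed on
  pairs of distinct points; for \<open>x = y\<close> the only arc would be the degenerate one \<open>{x}\<close>.
\<close>

definition metric_tree :: "'a set \<Rightarrow> ('a \<Rightarrow> 'a \<Rightarrow> real) \<Rightarrow> bool" where
  "metric_tree X d \<longleftrightarrow>
     Metric_space X d \<and>
     (\<forall>x\<in>X. \<forall>y\<in>X. x \<noteq> y \<longrightarrow>
        (\<exists>!A. arc_between X d A x y) \<and>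
        (\<forall>A. arc_between X d A x y \<longrightarrow> geodesic_segment_between X d A x y))"

definition positive_type_kernel :: "'a set \<Rightarrow> ('a \<Rightarrow> 'a \<Rightarrow> real) \<Rightarrow> bool" where
  "positive_type_kernel X \<Phi> \<longleftrightarrow>
     (\<forall>x\<in>X. \<forall>y\<in>X. \<Phi> x y = \<Phi> y x) \<and>
     (\<forall>(n::nat) (c :: nat \<Rightarrow> real) (x :: nat \<Rightarrow> 'a). (\<forall>i<n. x i \<in> X) \<longrightarrow>
        0 \<le> (\<Sum>j<n. \<Sum>k<n. c j * c k * \<Phi> (x j) (x k)))"

definition real_hyperbolic_kernel :: "'a set \<Rightarrow> ('a \<Rightarrow> 'a \<Rightarrow> real) \<Rightarrow> bool" where
  "real_hyperbolic_kernel X \<beta> \<longleftrightarrow>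
     (\<forall>x\<in>X. \<forall>y\<in>X. \<beta> x y = \<beta> y x) \<and>
     (\<forall>x\<in>X. \<forall>y\<in>X. 0 \<le> \<beta> x y) \<and>
     (\<forall>x\<in>X. \<beta> x x = 1) \<and>
     (\<forall>x\<^sub>0\<in>X. positive_type_kernel X (\<lambda>x y. \<beta> x x\<^sub>0 * \<beta> x\<^sub>0 y - \<beta> x y))"

end

(* Fix a base point w. In a tree, the geodesics from w to x and to y agree exactly up to time
   (x|y), the Gromov product based at w: the two branches after the last common point form an arc,
   which by uniqueness is the geodesic from x to y. Hence (x|z) >= min (x|y) (y|z). Up to the
   positive factor l^(d(x,w)+d(w,y)), which preserves positivity, the kernel in question is
   1 - l^(-2(x|y)), a nondecreasing function of (x|y); and a nonnegative kernel satisfying the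
   ultrametric inequality is of positive type. *)

theory Submission
  imports Defs
begin

section \<open>Ultrametric kernels\<close>

text \<open>Subtract the least entry \<open>m\<close>. The remaining kernel is still nonnegative and
  ultrametric, and it vanishes at some pair, so it splits into two blocks without cross terms. Each
  block is indexed by a proper subset, where induction applies, or is a single nonnegative entry.
  The constant kernel \<open>m\<close> contributes \<open>m\<close> times a square.\<close>

lemma ultrametric_kernel_sum_nonneg:
  fixes c :: "'i \<Rightarrow> real" and K :: "'i \<Rightarrow> 'i \<Rightarrow> real"
  assumes "finite I"
    and "\<And>i j. i \<in> I \<Longrightarrow> j \<in> I \<Longrightarrow> K i j = K j i"
    and "\<And>i j. i \<in> I \<Longrightarrow> j \<in> I \<Longrightarrow> 0 \<le> K i j"
    and "\<And>i j k. i \<in> I \<Longrightarrow> j \<in> I \<Longrightarrow> k \<in> I \<Longrightarrow> min (K i j) (K j k) \<le> K i k"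
  shows "0 \<le> (\<Sum>i\<in>I. \<Sum>j\<in>I. c i * c j * K i j)"
  using assms
proof (induction "card I" arbitrary: I K rule: less_induct)
  case less
  note fin = less.prems(1) and sym = less.prems(2) and nonneg = less.prems(3)
    and ultra = less.prems(4)
  show ?case
  proof (cases "I = {}")
    case False
    define V where "V = (\<lambda>(i, j). K i j) ` (I \<times> I)"
    define m where "m = Min V"
    have V: "finite V" "V \<noteq> {}"
      using fin False by (auto simp: V_def)
    obtain a b where ab: "a \<in> I" "b \<in> I" "K a b = m"
      using Min_in[OF V] by (auto simp: V_def m_def)
    have m_le: "m \<le> K i j" if "i \<in> I" "j \<in> I" for i j
      using V that by (auto simp: m_def V_def intro!: Min_le)
    have "0 \<le> m"
      using ab nonneg by metis
    define L where "L i j = K i j - m" for i j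
    have L_sym: "L i j = L j i" if "i \<in> I" "j \<in> I" for i j
      using sym that by (simp add: L_def)
    have L_nonneg: "0 \<le> L i j" if "i \<in> I" "j \<in> I" for i j
      using m_le that by (simp add: L_def)
    have L_ultra: "min (L i j) (L j k) \<le> L i k" if "i \<in> I" "j \<in> I" "k \<in> I" for i j k
      using ultra[OF that] by (auto simp: L_def)
    have smaller: "0 \<le> (\<Sum>i\<in>J. \<Sum>j\<in>J. c i * c j * L i j)" if "J \<subset> I" for J
    proof (rule less.hyps)
      show "card J < card I" "finite J"
        using that fin by (auto intro: psubset_card_mono finite_subset)
      show "L i j = L j i" if "i \<in> J" "j \<in> J" for i j
        using that \<open>J \<subset> I\<close> L_sym by blast
      show "0 \<le> L i j" if "i \<in> J" "j \<in> J" for i j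
        using that \<open>J \<subset> I\<close> L_nonneg by blast
      show "min (L i j) (L j k) \<le> L i k" if "i \<in> J" "j \<in> J" "k \<in> J" for i j k
        using that \<open>J \<subset> I\<close> L_ultra by blast
    qed
    \<comment> \<open>By symmetry and the ultrametric inequality, \<open>0 < L i j\<close> is a
      transitive relation, and \<open>B\<^sub>0\<close> is the class of \<open>a\<close>. It is
      empty when row \<open>a\<close> of \<open>L\<close> vanishes identically; then
      \<open>{a}\<close> itself is the block, which may be all of \<open>I\<close>.\<close>
    define B\<^sub>0 where "B\<^sub>0 = {j \<in> I. 0 < L a j}"
    define B where "B = (if B\<^sub>0 = {} then {a} else B\<^sub>0)"
    have B: "B \<subseteq> I" "B \<noteq> {}"
      using ab by (auto simp: B_def B\<^sub>0_def)
    have B_nonneg: "0 \<le> (\<Sum>i\<in>B. \<Sum>j\<in>B. c i * c j * L i j)"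
    proof (cases "B\<^sub>0 = {}")
      case True
      then show ?thesis
        using ab L_nonneg by (simp add: B_def)
    next
      case False
      \<comment> \<open>The minimum is attained at \<open>(a, b)\<close>, so
        \<open>L a b = 0\<close> and the class of \<open>a\<close> is a proper subset.\<close>
      have "b \<notin> B\<^sub>0"
        using ab by (simp add: B\<^sub>0_def L_def)
      then show ?thesis
        using False ab B by (intro smaller) (auto simp: B_def)
    qed
    have cross: "L i j = 0" if "i \<in> B" "j \<in> I - B" for i j
    proof (cases "B\<^sub>0 = {}")
      case True
      then show ?thesis
        using that ab L_nonneg[of a j] by (auto simp: B_def B\<^sub>0_def)
    next
      case False
      then have "B = B\<^sub>0"
        by (simp add: B_def)
      then have "i \<in> I" "0 < L a i" "j \<in> I" "\<not> 0 < L a j"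
        using that by (auto simp: B\<^sub>0_def)
      \<comment> \<open>Since \<open>L a j = 0\<close>, the ultrametric inequality makes
        \<open>L a i\<close> or \<open>L i j\<close> nonpositive, and the former is
        positive.\<close>
      then show ?thesis
        using L_ultra[of a i j] L_nonneg[of i j] ab(1) by linarith
    qed
    have split: "(\<Sum>i\<in>I. f i) = (\<Sum>i\<in>B. f i) + (\<Sum>i\<in>I - B. f i)" for f :: "'i \<Rightarrow> real"
      using sum.subset_diff[OF B(1) fin, of f] by simp
    have "(\<Sum>i\<in>B. \<Sum>j\<in>I - B. c i * c j * L i j) = 0"
      using cross by simp
    moreover have "(\<Sum>i\<in>I - B. \<Sum>j\<in>B. c i * c j * L i j) = 0"
    proof (intro sum.neutral ballI)
      fix i j assume "i \<in> I - B" "j \<in> B"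
      then show "c i * c j * L i j = 0"
        using cross[of j i] L_sym[of i j] B by auto
    qed
    moreover have "0 \<le> (\<Sum>i\<in>I - B. \<Sum>j\<in>I - B. c i * c j * L i j)"
      using B by (intro smaller) auto
    ultimately have "0 \<le> (\<Sum>i\<in>I. \<Sum>j\<in>I. c i * c j * L i j)"
      using B_nonneg by (simp add: split sum.distrib)
    moreover have "(\<Sum>i\<in>I. \<Sum>j\<in>I. c i * c j * K i j) =
        (\<Sum>i\<in>I. \<Sum>j\<in>I. c i * c j * L i j) + m * (\<Sum>i\<in>I. c i)\<^sup>2"
      by (simp add: L_def power2_eq_square sum_product sum_distrib_left
          sum.distrib[symmetric] algebra_simps)
    ultimately show ?thesis
      using \<open>0 \<le> m\<close> by simp
  qed simp
qed

section \<open>Geodesics in metric trees\<close>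

text \<open>Naming the parametrisation, which \<open>geodesic_segment_between\<close> hides under a
  quantifier, allows two geodesics to be compared time by time.\<close>

definition geodesic :: "'a set \<Rightarrow> ('a \<Rightarrow> 'a \<Rightarrow> real) \<Rightarrow> (real \<Rightarrow> 'a) \<Rightarrow> 'a \<Rightarrow> 'a \<Rightarrow> bool" where
  "geodesic X d \<gamma> x y \<longleftrightarrow>
     \<gamma> ` {0..d x y} \<subseteq> X \<and>
     (\<forall>s\<in>{0..d x y}. \<forall>t\<in>{0..d x y}. d (\<gamma> s) (\<gamma> t) = \<bar>s - t\<bar>) \<and>
     \<gamma> 0 = x \<and> \<gamma> (d x y) = y"

lemma geodesic_segment_between_iff:
  "geodesic_segment_between X d A x y \<longleftrightarrow> (\<exists>\<gamma>. geodesic X d \<gamma> x y \<and> A = \<gamma> ` {0..d x y})"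
  unfolding geodesic_segment_between_def geodesic_def by blast

section \<open>Arcs and geodesics in a general metric space\<close>

context Metric_space
begin

text \<open>The bound gives continuity, and an affine change of parameter moves the domain to the
  unit interval. An inequality is required instead of an isometry because the lemma must apply to a
  concatenation of geodesics not yet known to be geodesic.\<close>

lemma arc_between_Lipschitz:
  fixes h :: "real \<Rightarrow> 'a"
  assumes "a < b" and "h ` {a..b} \<subseteq> M" and inj: "inj_on h {a..b}"
    and lip: "\<And>u v. u \<in> {a..b} \<Longrightarrow> v \<in> {a..b} \<Longrightarrow> u \<le> v \<Longrightarrow> d (h u) (h v) \<le> v - u"
  shows "arc_between M d (h ` {a..b}) (h a) (h b)"
proof -
  define \<phi> where "\<phi> t = a + t * (b - a)" for t
  have \<phi>_image: "\<phi> ` {0..1} = {a..b}"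
  proof
    show "\<phi> ` {0..1} \<subseteq> {a..b}"
    proof clarify
      fix t :: real assume "t \<in> {0..1}"
      then have "0 \<le> t * (b - a)" "t * (b - a) \<le> 1 * (b - a)"
        using \<open>a < b\<close> by (auto intro!: mult_right_mono)
      then show "\<phi> t \<in> {a..b}"
        by (simp add: \<phi>_def)
    qed
    show "{a..b} \<subseteq> \<phi> ` {0..1}"
    proof
      fix u assume "u \<in> {a..b}"
      then show "u \<in> \<phi> ` {0..1}"
        using \<open>a < b\<close> by (intro image_eqI[of _ _ "(u - a) / (b - a)"]) (auto simp: \<phi>_def)
    qed
  qed
  have dist_le: "d (h u) (h v) \<le> \<bar>u - v\<bar>" if "u \<in> {a..b}" "v \<in> {a..b}" for u v
    using lip[OF that] lip[OF that(2,1)] commute[of "h u" "h v"] by linarith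
  have "pathin mtopology (h \<circ> \<phi>)"
    unfolding pathin_def
  proof (rule continuous_map_compose)
    show "continuous_map (top_of_set {0..1}) (top_of_set {a..b}) \<phi>"
      using \<phi>_image
      by (auto simp: continuous_map_in_subtopology image_subset_iff_funcset[symmetric] \<phi>_def
          simp del: image_add_atLeastAtMost intro!: continuous_intros)
    show "continuous_map (top_of_set {a..b}) mtopology h"
      unfolding continuous_map_to_metric
    proof (intro ballI allI impI)
      fix u and \<epsilon> :: real assume u: "u \<in> topspace (top_of_set {a..b})" and "0 < \<epsilon>"
      have "h v \<in> mball (h u) \<epsilon>" if "v \<in> {a..b} \<inter> ball u \<epsilon>" for v
        using that u dist_le[of u v] assms(2) by (force simp: dist_real_def)
      then show "\<exists>U. openin (top_of_set {a..b}) U \<and> u \<in> U \<and> (\<forall>v\<in>U. h v \<in> mball (h u) \<epsilon>)"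
        using u \<open>0 < \<epsilon>\<close> by (intro exI[of _ "{a..b} \<inter> ball u \<epsilon>"]) auto
    qed
  qed
  moreover have "inj_on \<phi> {0..1}"
    using \<open>a < b\<close> by (auto simp: inj_on_def \<phi>_def)
  then have "inj_on (h \<circ> \<phi>) {0..1}"
    using inj \<phi>_image by (simp add: comp_inj_on)
  moreover have "(h \<circ> \<phi>) 0 = h a" "(h \<circ> \<phi>) 1 = h b" "h ` {a..b} = (h \<circ> \<phi>) ` {0..1}"
    by (simp_all add: \<phi>_def image_image flip: \<phi>_image)
  ultimately show ?thesis
    unfolding arc_between_def by blast
qed

lemma geodesic_dist:
  assumes "geodesic M d \<gamma> x y" "s \<in> {0..d x y}" "t \<in> {0..d x y}"
  shows "d (\<gamma> s) (\<gamma> t) = \<bar>s - t\<bar>"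
  using assms by (simp add: geodesic_def)

text \<open>This recovers the parameter from the point: geodesics are injective, and two geodesics
  from the same start can meet only at equal times.\<close>

lemma geodesic_dist_start:
  assumes "geodesic M d \<gamma> x y" "t \<in> {0..d x y}"
  shows "d x (\<gamma> t) = t"
  using geodesic_dist[OF assms(1), of 0 t] assms by (auto simp: geodesic_def)

lemma geodesic_arc_between:
  assumes "geodesic M d \<gamma> x y" "x \<in> M" "y \<in> M" "x \<noteq> y"
  shows "arc_between M d (\<gamma> ` {0..d x y}) x y"
proof -
  have "inj_on \<gamma> {0..d x y}"
    by (metis inj_onI geodesic_dist_start[OF assms(1)])
  then have "arc_between M d (\<gamma> ` {0..d x y}) (\<gamma> 0) (\<gamma> (d x y))"
    using assms by (intro arc_between_Lipschitz) (auto simp: geodesic_def)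
  then show ?thesis
    using assms(1) by (simp add: geodesic_def)
qed

lemma geodesic_initial:
  assumes "geodesic M d \<gamma> x y" "t \<in> {0..d x y}"
  shows "geodesic M d \<gamma> x (\<gamma> t)"
  using assms geodesic_dist_start[OF assms] unfolding geodesic_def by auto

lemma geodesic_between_dist_add:
  assumes \<gamma>: "geodesic M d \<gamma> x y" and z: "z \<in> \<gamma> ` {0..d x y}"
  shows "d x y = d x z + d z y"
proof -
  obtain t where t: "t \<in> {0..d x y}" "z = \<gamma> t"
    using z by auto
  then show ?thesis
    using geodesic_dist_start[OF \<gamma>, of t] geodesic_dist[OF \<gamma>, of t "d x y"] \<gamma>
    by (auto simp: geodesic_def)
qed

end

section \<open>Uniqueness of geodesics in a tree\<close>

locale tree = Metric_space M d for M :: "'a set" and d :: "'a \<Rightarrow> 'a \<Rightarrow> real" +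
  assumes metric_tree: "metric_tree M d"
begin

lemma unique_arc:
  assumes "x \<in> M" "y \<in> M" "x \<noteq> y" "arc_between M d A x y" "arc_between M d B x y"
  shows "A = B"
  using metric_tree assms unfolding metric_tree_def by blast

lemma ex_geodesic:
  assumes "x \<in> M" "y \<in> M"
  shows "\<exists>\<gamma>. geodesic M d \<gamma> x y"
proof (cases "x = y")
  case True
  then show ?thesis
    using assms by (intro exI[of _ "\<lambda>_. x"]) (auto simp: geodesic_def)
next
  case False
  then have "\<exists>A. geodesic_segment_between M d A x y"
    using metric_tree assms unfolding metric_tree_def by blast
  then show ?thesis
    unfolding geodesic_segment_between_iff by blast
qed

text \<open>Uniqueness of arcs only identifies the images. The distance from \<open>x\<close> then
  fixes the parameter of each point, so the parametrisations agree as well.\<close>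

lemma geodesic_unique:
  assumes \<gamma>: "geodesic M d \<gamma> x y" and \<delta>: "geodesic M d \<delta> x y"
    and xy: "x \<in> M" "y \<in> M" and t: "t \<in> {0..d x y}"
  shows "\<gamma> t = \<delta> t"
proof (cases "x = y")
  case True
  then show ?thesis
    using assms by (auto simp: geodesic_def)
next
  case False
  have "\<gamma> ` {0..d x y} = \<delta> ` {0..d x y}"
    using unique_arc[OF xy False] geodesic_arc_between \<gamma> \<delta> xy False by blast
  then obtain s where s: "s \<in> {0..d x y}" "\<gamma> t = \<delta> s"
    using t by blast
  have "t = s"
    using geodesic_dist_start[OF \<gamma> t] geodesic_dist_start[OF \<delta> s(1)] s(2) by simp
  then show ?thesis
    using s by simp
qed

text \<open>Cut off at time \<open>t\<close>, both become geodesics from \<open>w\<close> to the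
  same point.\<close>

lemma geodesics_agree_before:
  assumes \<gamma>: "geodesic M d \<gamma> w x" and \<delta>: "geodesic M d \<delta> w y" and w: "w \<in> M"
    and t: "t \<in> {0..d w x}" "t \<in> {0..d w y}" and eq: "\<gamma> t = \<delta> t" and s: "s \<in> {0..t}"
  shows "\<gamma> s = \<delta> s"
proof (rule geodesic_unique)
  show "geodesic M d \<gamma> w (\<gamma> t)" "geodesic M d \<delta> w (\<gamma> t)"
    using geodesic_initial[OF \<gamma> t(1)] geodesic_initial[OF \<delta> t(2)] eq by auto
  show "w \<in> M" "\<gamma> t \<in> M"
    using w \<gamma> t by (auto simp: geodesic_def)
  show "s \<in> {0..d w (\<gamma> t)}"
    using geodesic_dist_start[OF \<gamma> t(1)] s by simp
qed

section \<open>Branching of geodesics and the Gromov product\<close>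

definition gromov_product :: "'a \<Rightarrow> 'a \<Rightarrow> 'a \<Rightarrow> real" where
  "gromov_product w x y = (d w x + d w y - d x y) / 2"

lemma gromov_product_commute: "gromov_product w x y = gromov_product w y x"
  by (simp add: gromov_product_def commute)

lemma gromov_product_bounds:
  assumes "w \<in> M" "x \<in> M" "y \<in> M"
  shows "0 \<le> gromov_product w x y" "gromov_product w x y \<le> d w x"
    "gromov_product w x y \<le> d w y"
  using triangle[of x w y] triangle[of w x y] triangle[of w y x] assms
  by (auto simp: gromov_product_def commute)

text \<open>Here \<open>p\<close> is the last time at which the geodesics meet. Running back from
  \<open>x\<close> to the branch point and on to \<open>y\<close> never repeats a point, so it
  traces an arc. By uniqueness this arc is the geodesic from \<open>x\<close> to \<open>y\<close>;
  the branch point thus lies on it and distances add up.\<close>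

lemma branch_dist_add:
  assumes \<gamma>: "geodesic M d \<gamma> w x" and \<delta>: "geodesic M d \<delta> w y"
    and M: "w \<in> M" "x \<in> M" "y \<in> M"
    and p: "p \<in> {0..d w x}" "p \<in> {0..d w y}" and eq: "\<gamma> p = \<delta> p"
    and branch: "\<And>t. p < t \<Longrightarrow> t \<le> d w x \<Longrightarrow> t \<le> d w y \<Longrightarrow> \<gamma> t \<noteq> \<delta> t"
  shows "d x y = (d w x - p) + (d w y - p)"
proof (cases "x = y")
  case True
  have "\<not> p < d w x"
  proof
    assume "p < d w x"
    then have "\<gamma> (d w x) \<noteq> \<delta> (d w x)"
      using branch True by auto
    then show False
      using \<gamma> \<delta> True by (simp add: geodesic_def)
  qed
  then show ?thesis
    using True M p by auto
next
  case False
  \<comment> \<open>The concatenated path \<open>h\<close> is at the branch point at time 0, at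
    \<open>x\<close> at time \<open>a\<close> and at \<open>y\<close> at time
    \<open>b\<close>.\<close>
  define a b where "a = p - d w x" and "b = d w y - p"
  define h where "h u = (if u \<le> 0 then \<gamma> (p - u) else \<delta> (p + u))" for u
  have ab: "a \<le> 0" "0 \<le> b"
    using p by (auto simp: a_def b_def)
  have h_neg: "h u = \<gamma> (p - u)" "p - u \<in> {0..d w x}" if "a \<le> u" "u \<le> 0" for u
    using that p by (auto simp: h_def a_def)
  have h_pos: "h u = \<delta> (p + u)" "p + u \<in> {0..d w y}" if "0 \<le> u" "u \<le> b" for u
    using that p eq by (auto simp: h_def b_def)
  have ends: "h a = x" "h b = y" "h 0 = \<gamma> p"
    using h_neg(1)[of a] h_pos(1)[of b] h_neg(1)[of 0] ab \<gamma> \<delta>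
    by (auto simp: a_def b_def geodesic_def)
  have "a < b"
    using ends False ab by (cases "a = b") auto
  have h_M: "h u \<in> M" if "u \<in> {a..b}" for u
  proof (cases "u \<le> 0")
    case True
    then show ?thesis
      using h_neg[of u] \<gamma> that by (auto simp: geodesic_def)
  next
    case False
    then show ?thesis
      using h_pos[of u] \<delta> that by (auto simp: geodesic_def)
  qed
  have neg: "d (h u) (h v) = v - u" if "a \<le> u" "u \<le> v" "v \<le> 0" for u v
    using that h_neg[of u] h_neg[of v] geodesic_dist[OF \<gamma>, of "p - u" "p - v"] by auto
  have pos: "d (h u) (h v) = v - u" if "0 \<le> u" "u \<le> v" "v \<le> b" for u v
    using that h_pos[of u] h_pos[of v] geodesic_dist[OF \<delta>, of "p + u" "p + v"] by auto
  have lip: "d (h u) (h v) \<le> v - u" if "u \<in> {a..b}" "v \<in> {a..b}" "u \<le> v" for u v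
  proof -
    consider "v \<le> 0" | "0 \<le> u" | "u \<le> 0" "0 \<le> v"
      by linarith
    then show ?thesis
    proof cases
      \<comment> \<open>Across the branch point only the triangle inequality through
        \<open>h 0\<close> is available at this stage.\<close>
      case 3
      then show ?thesis
        using triangle[of "h u" "h 0" "h v"] neg[of u 0] pos[of 0 v] h_M[of u] h_M[of 0] h_M[of v]
          that ab by simp
    qed (use that neg pos in auto)
  qed
  have neq: "h u \<noteq> h v" if "u \<in> {a..b}" "v \<in> {a..b}" "u < v" for u v
  proof -
    consider "v \<le> 0" | "0 \<le> u" | "u < 0" "0 < v"
      by linarith
    then show ?thesis
    proof cases
      \<comment> \<open>A common point of the two branches has one distance from \<open>w\<close>,
        so both geodesics would reach it at the same time, later than \<open>p\<close>.\<close>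
      case 3
      have u: "h u = \<gamma> (p - u)" "p - u \<in> {0..d w x}"
        using h_neg[of u] that 3 by auto
      have v: "h v = \<delta> (p + v)" "p + v \<in> {0..d w y}"
        using h_pos[of v] that 3 by auto
      show ?thesis
      proof
        assume *: "h u = h v"
        then have "p - u = p + v"
          using geodesic_dist_start[OF \<gamma> u(2)] geodesic_dist_start[OF \<delta> v(2)] u v by simp
        then show False
          using branch[of "p + v"] * u v 3 by auto
      qed
    next
      case 1
      then show ?thesis
        using neg[of u v] that h_M[of u] by force
    next
      case 2
      then show ?thesis
        using pos[of u v] that h_M[of u] by force
    qed
  qed
  have "inj_on h {a..b}"
  proof (rule inj_onI)
    fix u v assume "u \<in> {a..b}" "v \<in> {a..b}" "h u = h v"
    then show "u = v"
      using neq[of u v] neq[of v u] by force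
  qed
  then have arc: "arc_between M d (h ` {a..b}) x y"
    using arc_between_Lipschitz[OF \<open>a < b\<close> _ _ lip] h_M ends(1,2) by blast
  obtain \<eta> where \<eta>: "geodesic M d \<eta> x y"
    using ex_geodesic M by blast
  \<comment> \<open>The arc traced by \<open>h\<close> and the image of \<open>\<eta>\<close> are
    the same set.\<close>
  have "h 0 \<in> \<eta> ` {0..d x y}"
    using unique_arc[OF M(2,3) False arc geodesic_arc_between[OF \<eta> M(2,3) False]] ab by auto
  then have "d x y = d x (h 0) + d (h 0) y"
    by (rule geodesic_between_dist_add[OF \<eta>])
  then show ?thesis
    using neg[of a 0] pos[of 0 b] ab ends by (simp add: a_def b_def)
qed

text \<open>The times of agreement form an initial interval that contains its supremum
  \<open>p\<close>. No agreement occurs after \<open>p\<close>, so \<open>branch_dist_add\<close>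
  applies, and solving its equation for \<open>p\<close> yields the Gromov product.\<close>

lemma geodesics_agree_iff:
  assumes \<gamma>: "geodesic M d \<gamma> w x" and \<delta>: "geodesic M d \<delta> w y"
    and M: "w \<in> M" "x \<in> M" "y \<in> M" and t: "t \<in> {0..d w x}" "t \<in> {0..d w y}"
  shows "\<gamma> t = \<delta> t \<longleftrightarrow> t \<le> gromov_product w x y"
proof -
  define S where "S = {t \<in> {0..d w x} \<inter> {0..d w y}. \<gamma> t = \<delta> t}"
  define p where "p = Sup S"
  have "0 \<in> S"
    using \<gamma> \<delta> by (auto simp: S_def geodesic_def)
  have bdd: "bdd_above S"
    by (rule bdd_aboveI[of _ "d w x"]) (auto simp: S_def)
  have le_p: "s \<le> p" if "s \<in> S" for s
    using that bdd by (simp add: p_def cSup_upper)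
  have p: "p \<in> {0..d w x}" "p \<in> {0..d w y}"
    using le_p[OF \<open>0 \<in> S\<close>] \<open>0 \<in> S\<close> unfolding p_def by (auto simp: S_def intro!: cSup_least)
  have p_M: "\<gamma> p \<in> M" "\<delta> p \<in> M"
    using p \<gamma> \<delta> by (auto simp: geodesic_def)
  \<comment> \<open>Agreement passes to the supremum: from an agreement time \<open>s\<close> within
    \<open>e / 2\<close> of \<open>p\<close>, each geodesic moves less than \<open>e / 2\<close>
    until \<open>p\<close>.\<close>
  have "d (\<gamma> p) (\<delta> p) \<le> 0 + e" if "0 < e" for e
  proof -
    have "p - e / 2 < Sup S"
      using that by (simp add: p_def)
    then obtain s where s: "s \<in> S" "p - e / 2 < s"
      using less_cSup_iff[of S] \<open>0 \<in> S\<close> bdd by blast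
    then have s': "s \<in> {0..d w x}" "s \<in> {0..d w y}" "\<gamma> s = \<delta> s"
      by (auto simp: S_def)
    moreover from this \<gamma> have "\<gamma> s \<in> M"
      by (force simp: geodesic_def)
    ultimately show ?thesis
      using triangle[OF p_M(1) _ p_M(2), of "\<gamma> s"] le_p[OF s(1)] s(2)
        geodesic_dist[OF \<gamma> p(1) s'(1)] geodesic_dist[OF \<delta> s'(2) p(2)] by simp
  qed
  then have "d (\<gamma> p) (\<delta> p) \<le> 0"
    by (rule field_le_epsilon)
  then have eq: "\<gamma> p = \<delta> p"
    using p_M nonneg[of "\<gamma> p" "\<delta> p"] by (simp flip: zero)
  have "\<gamma> s \<noteq> \<delta> s" if "p < s" "s \<le> d w x" "s \<le> d w y" for s
    using that le_p[of s] p by (auto simp: S_def)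
  then have "d x y = (d w x - p) + (d w y - p)"
    using branch_dist_add[OF \<gamma> \<delta> M p eq] by blast
  then have "gromov_product w x y = p"
    by (simp add: gromov_product_def)
  moreover have "\<gamma> t = \<delta> t \<longleftrightarrow> t \<le> p"
    using le_p[of t] geodesics_agree_before[OF \<gamma> \<delta> M(1) p eq, of t] t by (auto simp: S_def)
  ultimately show ?thesis
    by simp
qed

text \<open>At time \<open>q\<close> the geodesic to \<open>y\<close> still coincides with the one
  to \<open>x\<close> and with the one to \<open>z\<close>, so these two coincide with each
  other.\<close>

lemma gromov_product_ultrametric:
  assumes M: "w \<in> M" "x \<in> M" "y \<in> M" "z \<in> M"
  shows "min (gromov_product w x y) (gromov_product w y z) \<le> gromov_product w x z"
proof -
  define q where "q = min (gromov_product w x y) (gromov_product w y z)"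
  obtain \<gamma> \<delta> \<eta> where geo: "geodesic M d \<gamma> w x" "geodesic M d \<delta> w y" "geodesic M d \<eta> w z"
    using ex_geodesic M by metis
  have q: "q \<in> {0..d w x}" "q \<in> {0..d w y}" "q \<in> {0..d w z}"
    using gromov_product_bounds[OF M(1,2,3)] gromov_product_bounds[OF M(1,3,4)]
    by (auto simp: q_def)
  have "\<gamma> q = \<delta> q"
    using geodesics_agree_iff[OF geo(1,2) M(1,2,3) q(1,2)] by (simp add: q_def)
  moreover have "\<delta> q = \<eta> q"
    using geodesics_agree_iff[OF geo(2,3) M(1,3,4) q(2,3)] by (simp add: q_def)
  ultimately have "q \<le> gromov_product w x z"
    using geodesics_agree_iff[OF geo(1,3) M(1,2,4) q(1,3)] by simp
  then show ?thesis
    by (simp add: q_def)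
qed

section \<open>Positive type of the exponential kernel\<close>

lemma positive_type_kernel_powr:
  fixes l :: real
  assumes "1 \<le> l" and w: "w \<in> M"
  shows "positive_type_kernel M (\<lambda>x y. l powr d x w * l powr d w y - l powr d x y)"
  unfolding positive_type_kernel_def
proof (intro conjI ballI allI impI)
  fix x y
  show "l powr d x w * l powr d w y - l powr d x y = l powr d y w * l powr d w x - l powr d y x"
    by (simp add: commute mult.commute)
next
  fix n :: nat and c :: "nat \<Rightarrow> real" and x :: "nat \<Rightarrow> 'a"
  assume x: "\<forall>i<n. x i \<in> M"
  \<comment> \<open>Since \<open>F\<close> is nondecreasing with \<open>F 0 = 0\<close>, it carries
    nonnegativity and the ultrametric inequality from Gromov products to \<open>K\<close>.\<close>
  define F where "F s = 1 - l powr (- 2 * s)" for s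
  define K where "K i j = F (gromov_product w (x i) (x j))" for i j
  have F_mono: "F s \<le> F t" if "s \<le> t" for s t
    using that \<open>1 \<le> l\<close> by (auto simp: F_def intro!: powr_mono)
  have factor: "l powr d u w * l powr d w v - l powr d u v =
      l powr d w u * l powr d w v * F (gromov_product w u v)" for u v
  proof -
    have "d u v = d w u + d w v + - 2 * gromov_product w u v"
      by (simp add: gromov_product_def field_simps)
    then have "l powr d u v = l powr d w u * l powr d w v * l powr (- 2 * gromov_product w u v)"
      by (simp only: powr_add)
    then show ?thesis
      by (simp add: F_def right_diff_distrib commute)
  qed
  \<comment> \<open>The factors split off in \<open>factor\<close> depend on one variable each and
    are absorbed into the coefficients.\<close>
  have "0 \<le> (\<Sum>j<n. \<Sum>k<n. (c j * l powr d w (x j)) * (c k * l powr d w (x k)) * K j k)"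
  proof (rule ultrametric_kernel_sum_nonneg)
    show "K i j = K j i" for i j
      by (simp add: K_def gromov_product_commute)
    show "0 \<le> K i j" if "i \<in> {..<n}" "j \<in> {..<n}" for i j
      using F_mono[of 0 "gromov_product w (x i) (x j)"] gromov_product_bounds(1) that x w \<open>1 \<le> l\<close>
      by (simp add: K_def F_def)
    show "min (K i j) (K j k) \<le> K i k" if "i \<in> {..<n}" "j \<in> {..<n}" "k \<in> {..<n}" for i j k
      using gromov_product_ultrametric[of w "x i" "x j" "x k"] that x w
      by (auto simp: K_def min_le_iff_disj intro: F_mono)
  qed simp
  then show "0 \<le> (\<Sum>j<n. \<Sum>k<n. c j * c k *
      (l powr d (x j) w * l powr d w (x k) - l powr d (x j) (x k)))"
    unfolding factor K_def by (simp add: mult_ac)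
qed

end

theorem proposition1p5:
  fixes X :: "'a set" and d :: "'a \<Rightarrow> 'a \<Rightarrow> real" and l :: real
  assumes "metric_tree X d" and "1 \<le> l"
  shows "real_hyperbolic_kernel X (\<lambda>x y. l powr d x y)"
proof -
  interpret Metric_space X d
    using assms(1) by (simp add: metric_tree_def)
  interpret tree X d
    using assms(1) by unfold_locales
  show ?thesis
    using positive_type_kernel_powr[OF assms(2)] assms(2)
    by (auto simp: real_hyperbolic_kernel_def commute)
qed

end
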